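(* Let $Z\subseteq\mathbb{R}^d$ be a full-dimensional zonotope and let $P=\mathrm{conv}\{x_1,\dots,x_N\}$ be a polytope with $N=\mathrm{poly}(d)$ vertices such that $P\subseteq Z\subseteq sP$ for some $s=s(d)$. Then $s\in\Omega\!\left(\sqrt{d/\log d}\right)$; that is, for every fixed polynomial bound on $N$ there is a constant $c>0$ such that $s\ge c\sqrt{d/\log d}$ for all such $Z$ and $P$ (for $d$ sufficiently large).
   Context: A zonotope is a set $\{Wx: x\in\mathbb{R}^n,\ \|x\|_\infty\le1\}$ with $W\in\mathbb{R}^{d\times n}$. *)

theory Defs
  imports
    "HOL-Analysis.Analysis"
    "HOL-Analysis.Finite_Function_Topology"
    "HOL-Computational_Algebra.Polynomial"
begin

text \<open>
  The constant in the theorem must not depend on the dimension \<open>d\<close>, so \<open>d\<close> has to be a number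
  inside the formula and cannot be a type. All the spaces \<open>\<real>\<^sup>d\<close> are therefore taken as the
  coordinate subspaces of the real vector space of finitely supported sequences, with
  coordinates indexed by \<open>0, \<dots>, d - 1\<close>. Scalar multiplication, convex hull and affine hull are
  the library's; a hull of a subset of \<open>euclidean_space_of_dim d\<close> stays inside \<open>euclidean_space_of_dim d\<close>.
\<close>

definition euclidean_space_of_dim :: "nat \<Rightarrow> (nat \<Rightarrow>\<^sub>0 real) set" where
  "euclidean_space_of_dim d = {v. Poly_Mapping.keys v \<subseteq> {..<d}}"

text \<open>
  For \<open>W \<in> \<real>\<^bsup>d\<times>n\<^esup>\<close> and \<open>x \<in> \<real>\<^sup>n\<close>, only the entries \<open>W i j\<close> and \<open>x j\<close> with \<open>i < d\<close>, \<open>j < n\<close>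
  matter; the two conditions below say \<open>\<parallel>x\<parallel>\<^sub>\<infinity> \<le> 1\<close> and \<open>z = W x\<close>.
\<close>

definition zonotope_of :: "nat \<Rightarrow> nat \<Rightarrow> (nat \<Rightarrow> nat \<Rightarrow> real) \<Rightarrow> (nat \<Rightarrow>\<^sub>0 real) set" where
  "zonotope_of d n W =
     {z \<in> euclidean_space_of_dim d. \<exists>x :: nat \<Rightarrow> real.
        (\<forall>j<n. \<bar>x j\<bar> \<le> 1) \<and>
        (\<forall>i<d. Poly_Mapping.lookup z i = (\<Sum>j<n. W i j * x j))}"

definition zonotope :: "nat \<Rightarrow> (nat \<Rightarrow>\<^sub>0 real) set \<Rightarrow> bool" where
  "zonotope d Z \<longleftrightarrow> (\<exists>n W. Z = zonotope_of d n W)"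

definition full_dimensional :: "nat \<Rightarrow> (nat \<Rightarrow>\<^sub>0 real) set \<Rightarrow> bool" where
  "full_dimensional d S \<longleftrightarrow> affine hull S = euclidean_space_of_dim d"

end

theory Submission
  imports Defs "Jordan_Normal_Form.Determinant"
begin

text \<open>
  Let \<open>w\<^sub>1, \<dots>, w\<^sub>n\<close> be the generators of \<open>Z\<close>. The support function \<open>h(a) = \<Sum>\<^sub>j \<bar>\<langle>a, w\<^sub>j\<rangle>\<bar>\<close> of \<open>Z\<close>
  satisfies \<open>h(a) \<le> s max\<^sub>k \<langle>a, x\<^sub>k\<rangle>\<close>. Choose a linear map \<open>T\<close> that nearly maximises
  \<open>\<bar>det T\<bar> / \<Phi>\<^sup>d\<close>, where \<open>\<Phi> = \<Sum>\<^sub>j \<parallel>T w\<^sub>j\<parallel>\<^sub>2\<close>. This approximate Lewis position forces every point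
  of \<open>T Z\<close>, in particular \<open>T x\<^sub>k\<close>, to have Euclidean norm \<open>O(\<Phi> / \<surd>d)\<close>. Now take \<open>a = T\<^sup>t e\<close>
  for a random sign vector \<open>e\<close>: by Khintchine's inequality the mean of \<open>h(a)\<close> is at least a
  constant times \<open>\<Phi>\<close>, while a subgaussian maximal inequality bounds the mean of
  \<open>max\<^sub>k \<langle>e, T x\<^sub>k\<rangle>\<close> by \<open>O(\<Phi> \<surd>(ln N / d))\<close>.
\<close>

section \<open>Averages over random signs\<close>

text \<open>The Taylor series are compared term by term, using
  \<open>2 ^ n * fact n \<le> fact (2 * n)\<close>. This is the subgaussian estimate for a single
  random sign.\<close>

lemma cosh_le_exp_half_square:
  fixes x :: real
  shows "cosh x \<le> exp (x\<^sup>2 / 2)"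
proof -
  have fct: "2 ^ n * fact n \<le> (fact (2 * n) :: real)" for n
  proof (induction n)
    case (Suc n)
    have "2 ^ Suc n * fact (Suc n) = (2 * (1 + real n)) * (2 ^ n * fact n)"
      by (simp add: algebra_simps)
    also have "\<dots> \<le> ((2 + 2 * real n) * (1 + 2 * real n)) * fact (2 * n)"
      by (intro mult_mono Suc.IH) (auto simp: field_simps)
    also have "\<dots> = fact (2 * Suc n)"
      by (simp add: algebra_simps)
    finally show ?case .
  qed simp
  have "(\<lambda>n. if even n then x ^ n /\<^sub>R fact n else 0) sums cosh x"
    by (rule cosh_converges)
  then have c: "(\<lambda>n. x ^ (2 * n) / fact (2 * n)) sums cosh x"
    by (subst (asm) sums_mono_reindex[of "\<lambda>n. 2 * n", symmetric])
       (auto simp: strict_mono_def field_simps elim!: evenE)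
  have e: "(\<lambda>n. (x\<^sup>2 / 2) ^ n /\<^sub>R fact n) sums exp (x\<^sup>2 / 2)"
    by (rule exp_converges)
  show ?thesis
  proof (rule sums_le[OF _ c e])
    fix n
    have "x ^ (2 * n) / fact (2 * n) \<le> x ^ (2 * n) / (2 ^ n * fact n)"
      by (rule divide_left_mono[OF fct]) auto
    also have "\<dots> = (x\<^sup>2 / 2) ^ n /\<^sub>R fact n"
      by (simp only: power_mult power_divide real_scaleR_def) (simp add: divide_inverse mult_ac)
    finally show "x ^ (2 * n) / fact (2 * n) \<le> (x\<^sup>2 / 2) ^ n /\<^sub>R fact n" .
  qed
qed

text \<open>The expectation of \<open>F e\<close>, where the coordinates \<open>e 0, \<dots>, e (d - 1)\<close> are independent random signs.\<close>

primrec sign_avg :: "nat \<Rightarrow> ((nat \<Rightarrow> real) \<Rightarrow> real) \<Rightarrow> real" where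
  "sign_avg 0 = (\<lambda>F. F (\<lambda>_. 0))"
| "sign_avg (Suc d) = (\<lambda>F. (sign_avg d (\<lambda>e. F (e(d := 1))) + sign_avg d (\<lambda>e. F (e(d := - 1)))) / 2)"

lemma sign_avg_const: "sign_avg d (\<lambda>e. c) = c"
  by (induction d) auto

lemma sign_avg_add: "sign_avg d (\<lambda>e. F e + G e) = sign_avg d F + sign_avg d G"
  by (induction d arbitrary: F G) (auto simp: field_simps)

lemma sign_avg_cmult: "sign_avg d (\<lambda>e. c * F e) = c * sign_avg d F"
  by (induction d arbitrary: F) (auto simp: algebra_simps)

lemma sign_avg_sum: "sign_avg d (\<lambda>e. \<Sum>j\<in>A. F j e) = (\<Sum>j\<in>A. sign_avg d (F j))"
  by (induction A rule: infinite_finite_induct) (auto simp: sign_avg_const sign_avg_add)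

lemma sign_avg_mono: "(\<And>e. F e \<le> G e) \<Longrightarrow> sign_avg d F \<le> sign_avg d G"
proof (induction d arbitrary: F G)
  case (Suc d)
  have "sign_avg d (\<lambda>e. F (e(d := c))) \<le> sign_avg d (\<lambda>e. G (e(d := c)))" for c
    by (intro Suc)
  from this[of 1] this[of "-1"] show ?case
    by simp
qed simp

lemma sign_avg_nonneg: "(\<And>e. 0 \<le> F e) \<Longrightarrow> 0 \<le> sign_avg d F"
  using sign_avg_mono[of "\<lambda>_. 0" F d] by (simp add: sign_avg_const)

text \<open>Averaging out the last sign first gives the induction step for all moment estimates.
  \<open>F\<close> stays a parameter so that powers and \<open>exp\<close> can be inserted.\<close>

lemma sign_avg_Suc_linear_form:
  "sign_avg (Suc d) (\<lambda>e. F (\<Sum>i<Suc d. e i * v i)) =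
     sign_avg d (\<lambda>e. (F ((\<Sum>i<d. e i * v i) + v d) + F ((\<Sum>i<d. e i * v i) - v d)) / 2)"
  by (simp add: sign_avg_add sign_avg_cmult[of _ "1/2", simplified])

section \<open>Moments of Rademacher sums\<close>

lemma sign_avg_square: "sign_avg d (\<lambda>e. (\<Sum>i<d. e i * v i)\<^sup>2) = (\<Sum>i<d. (v i)\<^sup>2)"
proof (induction d)
  case (Suc d)
  have "((s + t)\<^sup>2 + (s - t)\<^sup>2) / 2 = s\<^sup>2 + t\<^sup>2" for s t :: real
    by (simp add: power2_eq_square algebra_simps)
  then show ?case
    using Suc by (simp only: sign_avg_Suc_linear_form[where F = "\<lambda>s. s\<^sup>2"])
      (simp add: sign_avg_add sign_avg_const)
qed simp

lemma sign_avg_power4_le: "sign_avg d (\<lambda>e. (\<Sum>i<d. e i * v i) ^ 4) \<le> 3 * (\<Sum>i<d. (v i)\<^sup>2)\<^sup>2"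
proof (induction d)
  case (Suc d)
  let ?q = "\<Sum>i<d. (v i)\<^sup>2"
  have *: "((s + t) ^ 4 + (s - t) ^ 4) / 2 = s ^ 4 + 6 * t\<^sup>2 * s\<^sup>2 + t ^ 4" for s t :: real
    by (simp add: power2_eq_square power4_eq_xxxx algebra_simps)
  have "sign_avg (Suc d) (\<lambda>e. (\<Sum>i<Suc d. e i * v i) ^ 4) =
      sign_avg d (\<lambda>e. (\<Sum>i<d. e i * v i) ^ 4) + 6 * (v d)\<^sup>2 * ?q + (v d) ^ 4"
    by (simp only: sign_avg_Suc_linear_form[where F = "\<lambda>s. s ^ 4"] *)
      (simp add: sign_avg_add sign_avg_const sign_avg_cmult sign_avg_square)
  \<comment> \<open>Weakening the last coefficient from 1 to 3 completes the square; this is where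
    the constant 3 comes from.\<close>
  also have "\<dots> \<le> 3 * ?q\<^sup>2 + 6 * (v d)\<^sup>2 * ?q + 3 * (v d) ^ 4"
    using Suc by (intro add_mono) auto
  also have "\<dots> = 3 * (?q + (v d)\<^sup>2)\<^sup>2"
    by (simp add: power2_eq_square power4_eq_xxxx algebra_simps)
  finally show ?case by simp
qed simp

text \<open>By independence the moment generating function is a product of factors
  \<open>cosh (v i)\<close>, each bounded by \<open>cosh_le_exp_half_square\<close>.\<close>

lemma sign_avg_exp_le:
  "sign_avg d (\<lambda>e. exp (\<Sum>i<d. e i * v i)) \<le> exp ((\<Sum>i<d. (v i)\<^sup>2) / 2)"
proof (induction d)
  case (Suc d)
  have *: "(exp (s + t) + exp (s - t)) / 2 = cosh t * exp s" for s t :: real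
  proof -
    have "cosh t * exp s = (exp t * exp s + exp (- t) * exp s) / 2"
      by (simp add: cosh_def algebra_simps add_divide_distrib)
    also have "\<dots> = (exp (t + s) + exp (- t + s)) / 2"
      by (simp only: exp_add)
    finally show ?thesis
      by (simp add: add.commute)
  qed
  have "sign_avg (Suc d) (\<lambda>e. exp (\<Sum>i<Suc d. e i * v i)) =
      cosh (v d) * sign_avg d (\<lambda>e. exp (\<Sum>i<d. e i * v i))"
    by (simp only: sign_avg_Suc_linear_form[where F = exp] * sign_avg_cmult)
  also have "\<dots> \<le> exp ((v d)\<^sup>2 / 2) * exp ((\<Sum>i<d. (v i)\<^sup>2) / 2)"
    by (intro mult_mono cosh_le_exp_half_square Suc sign_avg_nonneg) auto
  also have "\<dots> = exp ((\<Sum>i<Suc d. (v i)\<^sup>2) / 2)"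
    by (simp add: exp_add[symmetric] add_divide_distrib add.commute)
  finally show ?case .
qed simp

text \<open>Khintchine's lower bound, obtained from the second and fourth moments; the constant is
  9/16 = 3/4 - 3/16.\<close>

lemma sign_avg_abs_ge:
  "9 / 16 * L2_set v {..<d} \<le> sign_avg d (\<lambda>e. \<bar>\<Sum>i<d. e i * v i\<bar>)"
proof (cases "L2_set v {..<d} = 0")
  case True
  then show ?thesis
    by (simp add: sign_avg_nonneg)
next
  case False
  define r where "r = L2_set v {..<d}"
  have r: "r > 0"
    using False by (simp add: r_def less_le)
  have r2: "(\<Sum>i<d. (v i)\<^sup>2) = r\<^sup>2"
    by (simp add: r_def L2_set_def sum_nonneg)
  have cub: "3 / 4 * y\<^sup>2 - 1 / 16 * y ^ 4 \<le> y" if "y \<ge> 0" for y :: real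
  proof -
    have "y - (3 / 4 * y\<^sup>2 - 1 / 16 * y ^ 4) = y * ((y - 2)\<^sup>2 * (y + 4)) / 16"
      by (simp add: power2_eq_square power4_eq_xxxx algebra_simps)
    also have "\<dots> \<ge> 0" using that by simp
    finally show ?thesis by simp
  qed
  \<comment> \<open>\<open>cub\<close>, tangent at \<open>y = 2\<close>, reduces the first absolute moment to the second and fourth.\<close>
  have pt: "3 / (4 * r) * s\<^sup>2 + - 1 / (16 * r ^ 3) * s ^ 4 \<le> \<bar>s\<bar>" for s
  proof -
    have 4: "\<bar>s\<bar> ^ 4 = s ^ 4"
      by (simp add: power_even_abs)
    have "r * (3 / 4 * (\<bar>s\<bar> / r)\<^sup>2 - 1 / 16 * (\<bar>s\<bar> / r) ^ 4) \<le> r * (\<bar>s\<bar> / r)"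
      using r by (intro mult_left_mono cub) auto
    also have "r * (3 / 4 * (\<bar>s\<bar> / r)\<^sup>2 - 1 / 16 * (\<bar>s\<bar> / r) ^ 4) =
        3 / 4 * (r / r\<^sup>2) * s\<^sup>2 - 1 / 16 * (r / r ^ 4) * s ^ 4"
      unfolding power_divide 4 by (simp add: algebra_simps)
    also have "r / r\<^sup>2 = 1 / r"
      using r by (simp add: power2_eq_square)
    also have "r / r ^ 4 = 1 / r ^ 3"
      using r by (simp add: power4_eq_xxxx power3_eq_cube)
    finally show ?thesis
      using r by simp
  qed
  have "3 / (4 * r) * r\<^sup>2 = 3 / 4 * r" 
    using r by (simp add: power2_eq_square)
  moreover have "- 1 / (16 * r ^ 3) * (3 * (r\<^sup>2)\<^sup>2) = - 3 / 16 * r"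
    using r by (simp add: power2_eq_square power3_eq_cube)
  ultimately have "9 / 16 * r = 3 / (4 * r) * r\<^sup>2 + - 1 / (16 * r ^ 3) * (3 * (r\<^sup>2)\<^sup>2)"
    by simp
  \<comment> \<open>The fourth moment has a negative coefficient, so its upper bound is the right
    one here.\<close>
  also have "\<dots> \<le> 3 / (4 * r) * r\<^sup>2 + - 1 / (16 * r ^ 3) * sign_avg d (\<lambda>e. (\<Sum>i<d. e i * v i) ^ 4)"
    using sign_avg_power4_le[of d v] r unfolding r2 
    by (intro add_left_mono mult_left_mono_neg) auto
  also have "\<dots> = sign_avg d (\<lambda>e. 3 / (4 * r) * (\<Sum>i<d. e i * v i)\<^sup>2 + - 1 / (16 * r ^ 3) * (\<Sum>i<d. e i * v i) ^ 4)"
    unfolding sign_avg_add sign_avg_cmult sign_avg_square r2 ..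
  also have "\<dots> \<le> sign_avg d (\<lambda>e. \<bar>\<Sum>i<d. e i * v i\<bar>)"
    by (intro sign_avg_mono pt)
  finally show ?thesis by (simp add: r_def)
qed

section \<open>Approximate Lewis position\<close>

text \<open>Sylvester's identity det (1 - U V) = det (1 - V U) for a column \<open>U\<close> and a
  row \<open>V\<close> leaves a 1 by 1 determinant. The identity comes from multiplying the block
  matrices \<open>?L\<close> and \<open>?M\<close> in both orders.\<close>

lemma det_one_minus_rank_one:
  fixes u :: "nat \<Rightarrow> 'a :: idom"
  shows "det (Matrix.mat d d (\<lambda>(i, j). (if i = j then 1 else 0) - c * u i * u j)) = 1 - c * (\<Sum>i<d. (u i)\<^sup>2)"
proof -
  define U where "U = Matrix.mat d 1 (\<lambda>(i, j). u i)"
  define V where "V = Matrix.mat 1 d (\<lambda>(i, j). c * u j)"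
  let ?L = "four_block_mat (1\<^sub>m 1) (0\<^sub>m 1 d) (- U) (1\<^sub>m d)"
  let ?M = "four_block_mat (1\<^sub>m 1) V U (1\<^sub>m d)"
  have c: "U \<in> carrier_mat d 1" "V \<in> carrier_mat 1 d" "- U \<in> carrier_mat d 1"
    by (auto simp: U_def V_def)
  have lr: "?L * ?M = four_block_mat (1\<^sub>m 1) V (0\<^sub>m d 1) (1\<^sub>m d - U * V)"
    using c by (subst mult_four_block_mat[of _ 1 1 _ d _ d _ _ 1 _ d]) 
       (auto intro!: arg_cong2[where f = "four_block_mat _ _"] eq_matI)
  have rl: "?M * ?L = four_block_mat (1\<^sub>m 1 - V * U) V (0\<^sub>m d 1) (1\<^sub>m d)"
    using c by (subst mult_four_block_mat[of _ 1 1 _ d _ d _ _ 1 _ d]) 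
       (auto intro!: cong_four_block_mat eq_matI)
  have cM: "?M \<in> carrier_mat (1 + d) (1 + d)" and cL: "?L \<in> carrier_mat (1 + d) (1 + d)"
    by (auto intro!: four_block_carrier_mat)
  have "det (1\<^sub>m d - U * V) = det (?L * ?M)"
    unfolding lr using c by (subst det_four_block_mat_lower_left_zero[of _ 1 _ d]) auto
  also have "\<dots> = det (?M * ?L)"
    by (simp only: det_mult[OF cM cL] det_mult[OF cL cM] mult.commute)
  also have "\<dots> = det (1\<^sub>m 1 - V * U)"
    unfolding rl using c by (subst det_four_block_mat_lower_left_zero[of _ 1 _ d]) auto
  also have "1\<^sub>m 1 - V * U = Matrix.mat 1 1 (\<lambda>_. 1 - c * (\<Sum>i<d. (u i)\<^sup>2))"
    by (auto intro!: eq_matI sum.cong simp: U_def V_def scalar_prod_def sum_distrib_left power2_eq_square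
         atLeast0LessThan mult.assoc)
  also have "det \<dots> = 1 - c * (\<Sum>i<d. (u i)\<^sup>2)"
    by (simp add: det_single)
  also have "1\<^sub>m d - U * V = Matrix.mat d d (\<lambda>(i, j). (if i = j then 1 else 0) - c * u i * u j)"
    by (auto intro!: eq_matI simp: U_def V_def scalar_prod_def)
  finally show ?thesis .
qed

lemma mat_mult_mat:
  "Matrix.mat d d (\<lambda>(i, j). A i j) * Matrix.mat d d (\<lambda>(i, j). B i j) =
   Matrix.mat d d (\<lambda>(i, j). \<Sum>k<d. A i k * B k j)"
  for A B :: "nat \<Rightarrow> nat \<Rightarrow> 'a :: comm_ring_1"
  by (auto intro!: eq_matI simp: scalar_prod_def atLeast0LessThan)

text \<open>The Leibniz formula has \<open>fact d\<close> terms, each a product of \<open>d\<close>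
  entries up to sign. The crude bound suffices, as it only serves to make a supremum finite.\<close>

lemma abs_det_le:
  fixes A :: "real mat"
  assumes "A \<in> carrier_mat d d" and "\<And>i j. i < d \<Longrightarrow> j < d \<Longrightarrow> \<bar>A $$ (i, j)\<bar> \<le> B"
  shows "\<bar>det A\<bar> \<le> fact d * B ^ d"
proof -
  have "\<bar>det A\<bar> \<le> (\<Sum>p | p permutes {0..<d}. \<bar>signof p * (\<Prod>i = 0..<d. A $$ (i, p i))\<bar>)"
    unfolding det_def'[OF assms(1)] by (rule sum_abs)
  also have "\<dots> \<le> (\<Sum>p | p permutes {0..<d}. B ^ d)"
  proof (rule sum_mono)
    fix p assume "p \<in> {p. p permutes {0..<d}}"
    then have p: "p permutes {0..<d}" by simp
    have "\<bar>signof p * (\<Prod>i = 0..<d. A $$ (i, p i))\<bar> = (\<Prod>i = 0..<d. \<bar>A $$ (i, p i)\<bar>)"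
      by (simp add: abs_mult abs_prod sign_def)
    also have "\<dots> \<le> (\<Prod>i = 0..<d. B)"
      using permutes_in_image[OF p] by (intro prod_mono) (auto intro!: assms(2))
    finally show "\<bar>signof p * (\<Prod>i = 0..<d. A $$ (i, p i))\<bar> \<le> B ^ d" by simp
  qed
  also have "\<dots> = fact d * B ^ d"
    by (simp add: card_permutations[of _ d])
  finally show ?thesis .
qed

section \<open>Lewis' functional and its near-maximisers\<close>

definition mat_apply :: "nat \<Rightarrow> (nat \<Rightarrow> nat \<Rightarrow> real) \<Rightarrow> (nat \<Rightarrow> real) \<Rightarrow> nat \<Rightarrow> real" where
  "mat_apply d T w i = (\<Sum>k<d. T i k * w k)"

text \<open>This is \<Phi> as a function of \<open>T\<close>. It is homogeneous of degree 1, so the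
  ratio of \<open>\<bar>mdet d T\<bar>\<close> to its \<open>d\<close>-th power is invariant under
  scaling of \<open>T\<close>.\<close>

definition norm_sum :: "nat \<Rightarrow> nat \<Rightarrow> (nat \<Rightarrow> nat \<Rightarrow> real) \<Rightarrow> (nat \<Rightarrow> nat \<Rightarrow> real) \<Rightarrow> real" where
  "norm_sum d n w T = (\<Sum>j<n. L2_set (mat_apply d T (w j)) {..<d})"

definition mdet :: "nat \<Rightarrow> (nat \<Rightarrow> nat \<Rightarrow> real) \<Rightarrow> real" where
  "mdet d T = Determinant.det (Matrix.mat d d (\<lambda>(i, j). T i j))"

lemma norm_sum_nonneg: "norm_sum d n w T \<ge> 0"
  by (simp add: norm_sum_def sum_nonneg)

text \<open>The hypothesis says that the vectors \<open>w j\<close> span, with \<open>C\<close> a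
  right inverse of the matrix of generators. Hence the entries of \<open>T\<close> are controlled by
  the vectors \<open>T w j\<close>, and \<open>abs_det_le\<close> applies.\<close>

lemma abs_mdet_le_norm_sum:
  assumes C: "\<And>i k. i < d \<Longrightarrow> k < d \<Longrightarrow> (\<Sum>j<n. w j i * C j k) = (if i = k then 1 else 0)"
  obtains B where "B \<ge> 0" "\<And>T. \<bar>mdet d T\<bar> \<le> B * norm_sum d n w T ^ d"
proof
  define M where "M = (\<Sum>j<n. \<Sum>k<d. \<bar>C j k\<bar>)"
  have M0: "M \<ge> 0"
    by (simp add: M_def sum_nonneg)
  then show "fact d * M ^ d \<ge> 0"
    by simp
  fix T
  have ent: "\<bar>T i k\<bar> \<le> M * norm_sum d n w T" if ik: "i < d" "k < d" for i k
  proof -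
    \<comment> \<open>With \<open>W\<close> the matrix of generators, \<open>W C = 1\<close> gives
      \<open>T = (T W) C\<close>.\<close>
    have "T i k = (\<Sum>l<d. T i l * (\<Sum>j<n. w j l * C j k))"
      using ik by (simp add: C if_distrib[of "\<lambda>x. _ * x"] cong: if_cong)
    also have "\<dots> = (\<Sum>j<n. mat_apply d T (w j) i * C j k)"
      unfolding mat_apply_def sum_distrib_left sum_distrib_right
      by (subst sum.swap) (simp add: mult.assoc)
    finally have "\<bar>T i k\<bar> \<le> (\<Sum>j<n. \<bar>mat_apply d T (w j) i\<bar> * \<bar>C j k\<bar>)"
      by (metis (no_types, lifting) abs_mult sum.cong sum_abs)
    also have "\<dots> \<le> (\<Sum>j<n. L2_set (mat_apply d T (w j)) {..<d} * M)"
    proof (intro sum_mono mult_mono)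
      fix j assume j: "j \<in> {..<n}"
      have "\<bar>mat_apply d T (w j) i\<bar> \<le> L2_set (\<lambda>i. \<bar>mat_apply d T (w j) i\<bar>) {..<d}"
        using ik by (intro member_le_L2_set) auto
      then show "\<bar>mat_apply d T (w j) i\<bar> \<le> L2_set (mat_apply d T (w j)) {..<d}"
        by (simp add: L2_set_def)
      have "\<bar>C j k\<bar> \<le> (\<Sum>k<d. \<bar>C j k\<bar>)"
        using ik by (intro member_le_sum) auto
      also have "\<dots> \<le> M"
        unfolding M_def using j
        by (intro member_le_sum[where f = "\<lambda>j. \<Sum>k<d. \<bar>C j k\<bar>"]) (auto simp: sum_nonneg)
      finally show "\<bar>C j k\<bar> \<le> M" .
    qed auto
    finally show ?thesis
      by (simp add: norm_sum_def sum_distrib_left mult.commute)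
  qed
  have "\<bar>mdet d T\<bar> \<le> fact d * (M * norm_sum d n w T) ^ d"
    unfolding mdet_def by (rule abs_det_le) (auto intro!: ent)
  then show "\<bar>mdet d T\<bar> \<le> fact d * M ^ d * norm_sum d n w T ^ d"
    by (simp add: power_mult_distrib)
qed

text \<open>Maximising up to a factor of \<open>2\<close> instead of exactly avoids a compactness argument.\<close>

lemma ex_nearly_maximal_det:
  assumes C: "\<And>i k. i < d \<Longrightarrow> k < d \<Longrightarrow> (\<Sum>j<n. w j i * C j k) = (if i = k then 1 else 0)"
  obtains T where "mdet d T \<noteq> 0"
    "\<And>T'. \<bar>mdet d T'\<bar> * norm_sum d n w T ^ d \<le> 2 * \<bar>mdet d T\<bar> * norm_sum d n w T' ^ d"
proof -
  obtain B where B0: "B \<ge> 0" and B: "\<And>T. \<bar>mdet d T\<bar> \<le> B * norm_sum d n w T ^ d"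
    using abs_mdet_le_norm_sum[OF C] by blast
  have pos: "norm_sum d n w T ^ d > 0" if "mdet d T \<noteq> 0" for T
  proof -
    have "0 < B * norm_sum d n w T ^ d"
      using B[of T] that by linarith
    then show ?thesis
      using B0 by (simp add: zero_less_mult_iff)
  qed
  \<comment> \<open>A vanishing denominator forces \<open>mdet d T = 0\<close> by \<open>B\<close>,
    so division by zero only yields the value 0.\<close>
  define val where "val T = \<bar>mdet d T\<bar> / norm_sum d n w T ^ d" for T
  have "val T \<le> B" for T
    using B0 B[of T] pos[of T] by (cases "mdet d T = 0") (auto simp: val_def pos_divide_le_eq)
  then have bdd: "bdd_above (range val)"
    by (intro bdd_aboveI[of _ B]) auto
  \<comment> \<open>The identity matrix shows that the supremum is positive, so half of it is
    strictly smaller and is exceeded by some \<open>T\<close>.\<close>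
  let ?I = "\<lambda>i k :: nat. if i = k then 1 else 0 :: real"
  have "Matrix.mat d d (\<lambda>(i, j). ?I i j) = 1\<^sub>m d"
    by (auto intro!: eq_matI)
  then have "mdet d ?I = 1"
    by (simp add: mdet_def)
  then have "0 < val ?I"
    using pos[of ?I] by (simp add: val_def)
  also have "\<dots> \<le> Sup (range val)"
    by (intro cSup_upper bdd) auto
  finally have S: "Sup (range val) > 0" .
  then have "Sup (range val) / 2 < Sup (range val)"
    by simp
  then obtain T where T: "Sup (range val) / 2 < val T"
    using less_cSup_iff[OF _ bdd, of "Sup (range val) / 2"] by auto
  have dT: "mdet d T \<noteq> 0"
    using T S by (auto simp: val_def)
  show ?thesis
  proof (rule that[OF dT])
    fix T'
    show "\<bar>mdet d T'\<bar> * norm_sum d n w T ^ d \<le> 2 * \<bar>mdet d T\<bar> * norm_sum d n w T' ^ d"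
    proof (cases "mdet d T' = 0")
      case False
      have "val T' \<le> Sup (range val)"
        by (intro cSup_upper bdd) auto
      also have "\<dots> \<le> 2 * val T"
        using T by simp
      finally show ?thesis
        using pos[OF dT] pos[OF False] by (simp add: val_def field_simps)
    qed (simp add: norm_sum_nonneg)
  qed
qed

text \<open>The concave square root lies below its tangent at \<open>x\<^sup>2\<close>. For
  \<open>x = 0\<close> the quotient is 0 and \<open>y\<close> vanishes.\<close>

lemma le_diff_of_square_eq:
  fixes x y b :: real
  assumes "x \<ge> 0" "y \<ge> 0" "b \<ge> 0" "y\<^sup>2 = x\<^sup>2 - b"
  shows "y \<le> x - b / (2 * x)"
proof (cases "x = 0")
  case True
  then have "y\<^sup>2 \<le> 0"
    using assms by simp
  then show ?thesis
    using True by simp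
next
  case False
  then have x: "x > 0"
    using assms by simp
  have "b \<le> x\<^sup>2"
    using assms by (metis diff_ge_0_iff_ge zero_le_power2)
  then have "b \<le> x * (2 * x)"
    using zero_le_power2[of x] unfolding power2_eq_square by linarith
  then have "b / (2 * x) \<le> x"
    using x by (simp add: pos_divide_le_eq)
  moreover have "y\<^sup>2 \<le> (x - b / (2 * x))\<^sup>2"
  proof -
    have "(x - b / (2 * x))\<^sup>2 = x\<^sup>2 - b + (b / (2 * x))\<^sup>2"
      using x by (simp add: power2_diff)
    then show ?thesis
      using assms by simp
  qed
  ultimately show ?thesis
    using power2_le_imp_le[of y "x - b / (2 * x)"] by simp
qed

text \<open>Multiply by \<open>(1 + y) ^ d\<close>: Bernoulli's inequality bounds the left side
  below, and \<open>(1 - y\<^sup>2) ^ d \<le> 1\<close> bounds the right side above.\<close>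

lemma power_one_minus_ge_imp:
  fixes y K :: real
  assumes "0 \<le> y" "y \<le> 1" "1 \<le> K * (1 - y) ^ d" "K \<ge> 0"
  shows "real d * y \<le> K - 1"
proof -
  have "1 * (1 + real d * y) \<le> K * (1 - y) ^ d * (1 + y) ^ d"
    using assms by (intro mult_mono Bernoulli_inequality) auto
  also have "\<dots> = K * (1 - y\<^sup>2) ^ d"
    by (simp add: power_mult_distrib[symmetric] power2_eq_square algebra_simps)
  also have "\<dots> \<le> K * 1"
    using assms by (intro mult_left_mono power_le_one) (auto simp: power_le_one)
  finally show ?thesis
    by simp
qed

text \<open>
  At an exact maximiser, the right-hand side would be \<open>norm_sum d n w T / d * (\<Sum>i<d. (u i)\<^sup>2)\<close>, with
  equality (Lewis' theorem for \<open>L\<^sub>1\<close>). Shrinking the direction \<open>u\<close> by one half costs a factor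
  \<open>2\<close> in the determinant, which must be compensated by a decrease of \<open>norm_sum\<close> that is not too large.
\<close>

lemma nearly_maximal_det_imp_lewis:
  fixes u :: "nat \<Rightarrow> real"
  assumes d: "d > 0" and T: "mdet d T \<noteq> 0"
    and max: "\<And>T'. \<bar>mdet d T'\<bar> * norm_sum d n w T ^ d \<le> 2 * \<bar>mdet d T\<bar> * norm_sum d n w T' ^ d"
  defines "v \<equiv> \<lambda>j. mat_apply d T (w j)"
  shows "(\<Sum>j<n. (\<Sum>i<d. u i * v j i)\<^sup>2 / L2_set (v j) {..<d}) \<le> 8 * norm_sum d n w T / real d * (\<Sum>i<d. (u i)\<^sup>2)"
proof (cases "(\<Sum>i<d. (u i)\<^sup>2) = 0")
  case True
  then have "\<And>i. i < d \<Longrightarrow> u i = 0"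
    by (subst (asm) sum_nonneg_eq_0_iff) auto
  then show ?thesis
    using True by simp
next
  case False
  define q where "q = (\<Sum>i<d. (u i)\<^sup>2)"
  have q: "q > 0"
    using False by (simp add: q_def less_le sum_nonneg)
  define F where "F = norm_sum d n w T"
  define a where "a j = (\<Sum>i<d. u i * v j i)" for j
  define A where "A = (\<Sum>j<n. (a j)\<^sup>2 / L2_set (v j) {..<d})"
  have A0: "A \<ge> 0"
    by (simp add: A_def sum_nonneg)
  have F: "F = (\<Sum>j<n. L2_set (v j) {..<d})"
    by (simp add: F_def norm_sum_def v_def)
  \<comment> \<open>\<open>?H\<close> halves the component along \<open>u\<close> and fixes the
    orthogonal complement, so its determinant is 1/2.\<close>
  let ?H = "\<lambda>i l. (if i = l then 1 else 0) - 1 / (2 * q) * u i * u l"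
  define T' where "T' i k = (\<Sum>l<d. ?H i l * T l k)" for i k
  have "mdet d T' = (1 - 1 / (2 * q) * q) * mdet d T"
    unfolding mdet_def T'_def mat_mult_mat[symmetric]
    by (subst det_mult[of _ d]) (auto simp only: det_one_minus_rank_one q_def mat_carrier)
  then have detT': "mdet d T' = 1 / 2 * mdet d T"
    using q by simp
  have v': "mat_apply d T' (w j) i = v j i - 1 / (2 * q) * a j * u i" if i: "i < d" for i j
  proof -
    have "mat_apply d T' (w j) i = (\<Sum>l<d. ?H i l * v j l)"
      unfolding mat_apply_def T'_def v_def sum_distrib_left sum_distrib_right
      by (subst sum.swap) (simp add: mult.assoc)
    also have "\<dots> = v j i - (\<Sum>l<d. 1 / (2 * q) * u i * (u l * v j l))"
      using i by (simp add: left_diff_distrib sum_subtractf if_distrib[of "\<lambda>x. x * _"] mult.assoc cong: if_cong)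
    also have "(\<Sum>l<d. 1 / (2 * q) * u i * (u l * v j l)) = 1 / (2 * q) * a j * u i"
      by (simp only: sum_distrib_left[symmetric] a_def) (simp only: mult_ac)
    finally show ?thesis .
  qed
  \<comment> \<open>Halving the component along \<open>u\<close>, whose squared length is
    \<open>(a j)\<^sup>2 / q\<close>, removes 3/4 of that from the squared length of
    \<open>v j\<close>. The tangent bound for the square root turns 3/4 into 3/8.\<close>
  have step: "L2_set (mat_apply d T' (w j)) {..<d} \<le>
      L2_set (v j) {..<d} - 3 / (8 * q) * ((a j)\<^sup>2 / L2_set (v j) {..<d})" for j
  proof -
    have sq: "(L2_set f {..<d})\<^sup>2 = (\<Sum>i<d. (f i)\<^sup>2)" for f
      by (simp add: L2_set_def sum_nonneg)
    have "(L2_set (mat_apply d T' (w j)) {..<d})\<^sup>2 = (\<Sum>i<d. (v j i - 1 / (2 * q) * a j * u i)\<^sup>2)"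
      unfolding sq by (intro sum.cong) (auto simp: v')
    also have "\<dots> = (\<Sum>i<d. (v j i)\<^sup>2 - a j / q * (u i * v j i) + (a j / (2 * q))\<^sup>2 * (u i)\<^sup>2)"
      using q by (intro sum.cong) (auto simp: power2_eq_square field_simps)
    also have "\<dots> = (L2_set (v j) {..<d})\<^sup>2 - a j / q * a j + (a j / (2 * q))\<^sup>2 * q"
      unfolding sq by (simp only: sum.distrib sum_subtractf sum_distrib_left[symmetric] a_def q_def)
    also have "\<dots> = (L2_set (v j) {..<d})\<^sup>2 - 3 / (4 * q) * (a j)\<^sup>2"
      using q by (simp add: power2_eq_square field_simps)
    finally have "L2_set (mat_apply d T' (w j)) {..<d} \<le> L2_set (v j) {..<d} - 3 / (4 * q) * (a j)\<^sup>2 / (2 * L2_set (v j) {..<d})"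
      using q by (intro le_diff_of_square_eq) auto
    then show ?thesis
      by simp
  qed
  have F': "norm_sum d n w T' \<le> F - 3 / (8 * q) * A"
    unfolding norm_sum_def F A_def sum_distrib_left sum_subtractf[symmetric]
    by (intro sum_mono step)
  have "A \<le> 8 * F / real d * q"
  proof (cases "F > 0")
    case False
    then have "3 / (8 * q) * A \<le> 0" and F0: "F = 0"
      using F' norm_sum_nonneg[of d n w T'] norm_sum_nonneg[of d n w T] by (auto simp: F_def)
    then have "A \<le> 0"
      using q by (simp add: field_simps)
    then show ?thesis
      using F0 by simp
  next
    case True
    \<comment> \<open>\<open>y\<close> is the guaranteed relative decrease of
      \<open>norm_sum\<close> on passing from \<open>T\<close> to \<open>T'\<close>.\<close>
    define y where "y = 3 * A / (8 * q * F)"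
    have y0: "y \<ge> 0"
      using A0 q True by (simp add: y_def)
    have F'': "norm_sum d n w T' \<le> F * (1 - y)"
      using F' True q by (simp add: y_def right_diff_distrib)
    then have "0 \<le> F * (1 - y)"
      using norm_sum_nonneg[of d n w T'] by linarith
    then have y1: "y \<le> 1"
      using True by (simp add: zero_le_mult_iff)
    \<comment> \<open>One factor 2 comes from near-maximality, the other from the halved
      determinant.\<close>
    have "\<bar>mdet d T\<bar> * F ^ d \<le> 4 * \<bar>mdet d T\<bar> * norm_sum d n w T' ^ d"
      using max[of T'] unfolding detT' F_def[symmetric] by (simp add: abs_mult)
    then have "F ^ d \<le> 4 * norm_sum d n w T' ^ d"
      using T by (simp add: mult.left_commute[of 4] mult.assoc)
    also have "\<dots> \<le> 4 * (F * (1 - y)) ^ d"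
      using F'' by (intro mult_left_mono power_mono norm_sum_nonneg) auto
    also have "\<dots> = F ^ d * (4 * (1 - y) ^ d)"
      by (simp add: power_mult_distrib)
    finally have "1 \<le> 4 * (1 - y) ^ d"
      using True by (simp add: mult_le_cancel_left1)
    then have "real d * y \<le> 3"
      using power_one_minus_ge_imp[of y 4 d] y0 y1 by simp
    then show ?thesis
      using True q d by (simp add: y_def field_simps)
  qed
  then show ?thesis
    unfolding A_def a_def F_def q_def .
qed

text \<open>For a point \<open>u\<close> of the zonotope, its squared norm \<open>q\<close> is the
  sum of \<open>a j * t j\<close>. Cauchy-Schwarz with weights \<open>l j\<close>, and the
  hypothesis at this same \<open>u\<close>, bound \<open>q\<close> by the square root of
  \<open>K * q\<close> times the sum of the \<open>l j\<close>; then \<open>q\<close>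
  cancels.\<close>

lemma lewis_imp_zonotope_bounded:
  fixes v :: "nat \<Rightarrow> nat \<Rightarrow> real"
  assumes lewis: "\<And>u. (\<Sum>j<n. (\<Sum>i<d. u i * v j i)\<^sup>2 / L2_set (v j) {..<d}) \<le> K * (\<Sum>i<d. (u i)\<^sup>2)"
    and K: "K \<ge> 0"
    and t: "\<And>j. j < n \<Longrightarrow> \<bar>t j\<bar> \<le> 1"
  shows "(\<Sum>i<d. (\<Sum>j<n. v j i * t j)\<^sup>2) \<le> K * (\<Sum>j<n. L2_set (v j) {..<d})"
proof -
  define u where "u i = (\<Sum>j<n. v j i * t j)" for i
  define q where "q = (\<Sum>i<d. (u i)\<^sup>2)"
  define a where "a j = (\<Sum>i<d. u i * v j i)" for j
  define l where "l j = L2_set (v j) {..<d}" for j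
  have l0: "l j \<ge> 0" for j
    by (simp add: l_def)
  \<comment> \<open>Zero generators contribute nothing, so division by \<open>sqrt (l j)\<close> is
    harmless.\<close>
  have a0: "a j = 0" if "l j = 0" for j
    using that by (simp add: l_def L2_set_eq_0_iff a_def)
  have q0: "q \<ge> 0"
    by (simp add: q_def sum_nonneg)
  have "q = (\<Sum>i<d. \<Sum>j<n. u i * (v j i * t j))"
    by (simp add: q_def power2_eq_square sum_distrib_left[symmetric] u_def)
  also have "\<dots> = (\<Sum>j<n. a j * t j)"
    by (subst sum.swap) (simp add: a_def sum_distrib_right mult.assoc)
  also have "\<dots> \<le> (\<Sum>j<n. \<bar>sqrt (l j)\<bar> * \<bar>a j / sqrt (l j)\<bar>)"
  proof (rule sum_mono)
    fix j assume "j \<in> {..<n}"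
    then have "\<bar>a j\<bar> * \<bar>t j\<bar> \<le> \<bar>a j\<bar> * 1"
      by (intro mult_left_mono t) auto
    then have "a j * t j \<le> \<bar>a j\<bar>"
      using abs_ge_self[of "a j * t j"] by (simp add: abs_mult)
    then show "a j * t j \<le> \<bar>sqrt (l j)\<bar> * \<bar>a j / sqrt (l j)\<bar>"
      using a0[of j] by (cases "l j = 0") (auto simp: abs_mult)
  qed
  also have "\<dots> \<le> L2_set (\<lambda>j. sqrt (l j)) {..<n} * L2_set (\<lambda>j. a j / sqrt (l j)) {..<n}"
    by (rule L2_set_mult_ineq)
  also have "\<dots> = sqrt ((\<Sum>j<n. l j) * (\<Sum>j<n. (a j)\<^sup>2 / l j))"
    by (simp add: L2_set_def power_divide l0 real_sqrt_mult)
  also have "\<dots> \<le> sqrt ((\<Sum>j<n. l j) * (K * q))"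
    using lewis[of u] by (intro real_sqrt_le_mono mult_left_mono) (auto simp: a_def l_def q_def sum_nonneg)
  finally have "q\<^sup>2 \<le> (sqrt ((\<Sum>j<n. l j) * (K * q)))\<^sup>2"
    using q0 by (intro power_mono) auto
  also have "\<dots> = (K * (\<Sum>j<n. l j)) * q"
    using q0 K by (simp add: l0 sum_nonneg)
  finally have "q * q \<le> (K * (\<Sum>j<n. l j)) * q"
    by (simp add: power2_eq_square)
  moreover have "K * (\<Sum>j<n. l j) \<ge> 0"
    using K by (simp add: l0 sum_nonneg)
  ultimately have "q \<le> K * (\<Sum>j<n. l j)"
    using q0 by (cases "q = 0") auto
  then show ?thesis
    by (simp add: q_def u_def l_def)
qed

section \<open>Polytopal approximation of zonotopes\<close>

text \<open>Average \<open>dom\<close> over random signs \<open>e\<close>: Khintchine bounds the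
  left side below, and Massart's maximal inequality for at most \<open>exp L\<close> vectors of norm
  at most \<open>R\<close> bounds the right side above.\<close>

lemma sign_avg_distortion_bound:
  fixes v :: "nat \<Rightarrow> nat \<Rightarrow> real" and y :: "'k \<Rightarrow> nat \<Rightarrow> real"
  assumes K: "finite K" "real (card K) \<le> exp L" and L: "L > 0" and R: "R > 0" and s: "s > 0"
    and y: "\<And>k. k \<in> K \<Longrightarrow> (\<Sum>i<d. (y k i)\<^sup>2) \<le> R\<^sup>2"
    and dom: "\<And>e. \<exists>k\<in>K. (\<Sum>j<n. \<bar>\<Sum>i<d. e i * v j i\<bar>) \<le> s * (\<Sum>i<d. e i * y k i)"
  shows "9 / 16 * (\<Sum>j<n. L2_set (v j) {..<d}) \<le> s * (R * sqrt (2 * L))"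
proof -
  define l where "l = sqrt (2 * L) / R"
  have l: "l > 0"
    using L R by (simp add: l_def)
  have lR: "l\<^sup>2 * R\<^sup>2 = 2 * L"
    using L R by (simp add: l_def power_divide)
  define h where "h e = (\<Sum>j<n. \<bar>\<Sum>i<d. e i * v j i\<bar>)" for e
  \<comment> \<open>\<open>l\<close> optimises the moment bound; Jensen's inequality is replaced by the tangent of \<open>exp\<close> at \<open>2 * L\<close>.\<close>
  have pt: "l / s * h e + (1 - 2 * L) \<le> (\<Sum>k\<in>K. exp (- 2 * L) * exp (\<Sum>i<d. e i * (l * y k i)))" for e
  proof -
    obtain k where k: "k \<in> K" "h e \<le> s * (\<Sum>i<d. e i * y k i)"
      using dom unfolding h_def by blast
    then have "h e / s \<le> (\<Sum>i<d. e i * y k i)"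
      using s by (simp add: pos_divide_le_eq mult.commute)
    then have "l * (h e / s) \<le> l * (\<Sum>i<d. e i * y k i)"
      using l by (intro mult_left_mono) auto
    then have le: "l / s * h e \<le> (\<Sum>i<d. e i * (l * y k i))"
      by (simp add: sum_distrib_left mult_ac)
    have "l / s * h e + (1 - 2 * L) \<le> exp (l / s * h e - 2 * L)"
      using exp_ge_add_one_self[of "l / s * h e - 2 * L"] by linarith
    also have "\<dots> \<le> exp (- 2 * L) * exp (\<Sum>i<d. e i * (l * y k i))"
      unfolding exp_add[symmetric] exp_le_cancel_iff using le by linarith
    also have "\<dots> \<le> (\<Sum>k\<in>K. exp (- 2 * L) * exp (\<Sum>i<d. e i * (l * y k i)))"
      using K k by (intro member_le_sum) auto
    finally show ?thesis .
  qed
  have "l / s * (9 / 16 * (\<Sum>j<n. L2_set (v j) {..<d})) + (1 - 2 * L) \<le> l / s * sign_avg d h + (1 - 2 * L)"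
    unfolding h_def sign_avg_sum sum_distrib_left[of "9 / 16"] using l s
    by (intro add_right_mono mult_left_mono sum_mono sign_avg_abs_ge) auto
  also have "\<dots> = sign_avg d (\<lambda>e. l / s * h e + (1 - 2 * L))"
    by (simp only: sign_avg_add sign_avg_cmult sign_avg_const)
  also have "\<dots> \<le> sign_avg d (\<lambda>e. \<Sum>k\<in>K. exp (- 2 * L) * exp (\<Sum>i<d. e i * (l * y k i)))"
    by (intro sign_avg_mono pt)
  also have "\<dots> = (\<Sum>k\<in>K. exp (- 2 * L) * sign_avg d (\<lambda>e. exp (\<Sum>i<d. e i * (l * y k i))))"
    by (simp only: sign_avg_sum sign_avg_cmult)
  \<comment> \<open>Since \<open>l\<^sup>2 * R\<^sup>2 = 2 * L\<close>, each exponential average is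
    at most \<open>exp L\<close>. The whole sum is then at most 1, which cancels the 1 in
    \<open>1 - 2 * L\<close>.\<close>
  also have "\<dots> \<le> (\<Sum>k\<in>K. exp (- 2 * L) * exp L)"
  proof (intro sum_mono mult_left_mono)
    fix k assume k: "k \<in> K"
    have "(\<Sum>i<d. (l * y k i)\<^sup>2) = l\<^sup>2 * (\<Sum>i<d. (y k i)\<^sup>2)"
      by (simp add: power_mult_distrib sum_distrib_left)
    also have "\<dots> \<le> l\<^sup>2 * R\<^sup>2"
      using y[OF k] by (intro mult_left_mono) auto
    finally have "exp ((\<Sum>i<d. (l * y k i)\<^sup>2) / 2) \<le> exp L"
      by (simp add: lR)
    then show "sign_avg d (\<lambda>e. exp (\<Sum>i<d. e i * (l * y k i))) \<le> exp L"
      by (rule order_trans[OF sign_avg_exp_le])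
  qed auto
  also have "\<dots> = real (card K) * exp (- L)"
    by (simp add: exp_add[symmetric])
  also have "\<dots> \<le> exp L * exp (- L)"
    using K by (intro mult_right_mono) auto
  also have "\<dots> = 1"
    by (simp add: exp_minus)
  finally have "l / s * (9 / 16 * (\<Sum>j<n. L2_set (v j) {..<d})) \<le> 2 * L"
    by simp
  then have "sqrt (2 * L) * (9 / 16 * (\<Sum>j<n. L2_set (v j) {..<d})) \<le> sqrt (2 * L) * (s * (R * sqrt (2 * L)))"
    using s R L by (simp add: l_def field_simps)
  then show ?thesis
    using L by simp
qed

text \<open>Adjointness: it carries an inequality in the direction \<open>T\<^sup>t e\<close> over
  to the images under \<open>T\<close>.\<close>

lemma sum_transpose_mat_apply:
  "(\<Sum>i<d. (\<Sum>l<d. e l * T l i) * w i) = (\<Sum>l<d. e l * mat_apply d T w l)"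
  unfolding mat_apply_def sum_distrib_left sum_distrib_right
  by (subst sum.swap) (simp add: mult.assoc)

lemma zonotope_approximation_bound:
  fixes w :: "nat \<Rightarrow> nat \<Rightarrow> real" and z :: "'k \<Rightarrow> nat \<Rightarrow> real"
  assumes d: "d > 0" and C: "\<And>i k. i < d \<Longrightarrow> k < d \<Longrightarrow> (\<Sum>j<n. w j i * C j k) = (if i = k then 1 else 0)"
    and K: "finite K" "real (card K) \<le> exp L" and L: "L > 0" and s: "s > 0"
    and z: "\<And>k. k \<in> K \<Longrightarrow> \<exists>t. (\<forall>j<n. \<bar>t j\<bar> \<le> 1) \<and> (\<forall>i<d. z k i = (\<Sum>j<n. w j i * t j))"
    and dom: "\<And>a. \<exists>k\<in>K. (\<Sum>j<n. \<bar>\<Sum>i<d. a i * w j i\<bar>) \<le> s * (\<Sum>i<d. a i * z k i)"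
  shows "s \<ge> 9 / 64 * sqrt (real d / L)"
proof -
  obtain T where T: "mdet d T \<noteq> 0"
    "\<And>T'. \<bar>mdet d T'\<bar> * norm_sum d n w T ^ d \<le> 2 * \<bar>mdet d T\<bar> * norm_sum d n w T' ^ d"
    using ex_nearly_maximal_det[OF C] by blast
  define v where "v j = mat_apply d T (w j)" for j
  define F where "F = norm_sum d n w T"
  have F: "F = (\<Sum>j<n. L2_set (v j) {..<d})"
    by (simp add: F_def norm_sum_def v_def)
  \<comment> \<open>\<open>F = 0\<close> would force \<open>mdet d T = 0\<close>, because
    \<open>d > 0\<close>.\<close>
  have "F > 0"
  proof -
    obtain B where "\<And>T. \<bar>mdet d T\<bar> \<le> B * norm_sum d n w T ^ d"
      using abs_mdet_le_norm_sum[OF C] by blast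
    from this[of T] have "F \<noteq> 0"
      using T(1) d by (auto simp: F_def zero_power)
    then show ?thesis
      using norm_sum_nonneg[of d n w T] by (simp add: F_def)
  qed
  have lewis: "(\<Sum>j<n. (\<Sum>i<d. u i * v j i)\<^sup>2 / L2_set (v j) {..<d}) \<le> 8 * F / real d * (\<Sum>i<d. (u i)\<^sup>2)" for u
    unfolding v_def F_def by (rule nearly_maximal_det_imp_lewis[OF d T])
  have bound: "(\<Sum>i<d. (mat_apply d T (z k) i)\<^sup>2) \<le> (sqrt (8 / d) * F)\<^sup>2" if k: "k \<in> K" for k
  proof -
    obtain t where t: "\<And>j. j < n \<Longrightarrow> \<bar>t j\<bar> \<le> 1" "\<And>i. i < d \<Longrightarrow> z k i = (\<Sum>j<n. w j i * t j)"
      using z[OF k] by blast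
    have "mat_apply d T (z k) i = (\<Sum>j<n. v j i * t j)" for i
      unfolding mat_apply_def v_def sum_distrib_right
      by (subst sum.swap) (simp add: t(2) sum_distrib_left mult.assoc)
    then have "(\<Sum>i<d. (mat_apply d T (z k) i)\<^sup>2) \<le> 8 * F / real d * F"
      using lewis_imp_zonotope_bounded[OF lewis _ t(1)] \<open>F > 0\<close> by (simp add: F)
    then show ?thesis
      by (simp add: power_mult_distrib power2_eq_square[of F])
  qed
  have "9 / 16 * (\<Sum>j<n. L2_set (v j) {..<d}) \<le> s * ((sqrt (8 / d) * F) * sqrt (2 * L))"
  proof (rule sign_avg_distortion_bound[OF K L _ s bound])
    show "\<exists>k\<in>K. (\<Sum>j<n. \<bar>\<Sum>i<d. e i * v j i\<bar>) \<le> s * (\<Sum>i<d. e i * mat_apply d T (z k) i)" for e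
      using dom[of "\<lambda>i. \<Sum>l<d. e l * T l i"] by (simp add: sum_transpose_mat_apply v_def)
  qed (use \<open>F > 0\<close> d in auto)
  \<comment> \<open>The radius \<open>sqrt (8 / d) * F\<close> is proportional to \<open>F\<close>,
    so \<open>F\<close> cancels; 9/64 is 9/16 divided by 4.\<close>
  then have "9 / 16 \<le> s * (sqrt (8 / d) * sqrt (2 * L))"
    using \<open>F > 0\<close> unfolding F[symmetric] by (simp add: field_simps)
  also have "sqrt (8 / d) * sqrt (2 * L) = 4 * sqrt (L / d)"
    unfolding real_sqrt_mult[symmetric] by (simp add: real_sqrt_divide real_sqrt_mult)
  finally have *: "9 / 64 \<le> s * sqrt (L / d)"
    by simp
  have "9 / 64 * sqrt (d / L) \<le> s * sqrt (L / d) * sqrt (d / L)"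
    by (intro mult_right_mono *) (use L in auto)
  also have "\<dots> = s"
    using L d by (simp add: mult.assoc real_sqrt_mult[symmetric])
  finally show ?thesis .
qed

section \<open>From finitely supported sequences to coordinates\<close>

lemma lookup_scaleR: "Poly_Mapping.lookup (r *\<^sub>R x) i = r *\<^sub>R Poly_Mapping.lookup x i"
proof -
  have "finite {i. r *\<^sub>R Poly_Mapping.lookup x i \<noteq> 0}"
    by (rule finite_subset[OF _ finite_lookup[of x]]) auto
  then show ?thesis
    by (simp add: scaleR_poly_mapping_def)
qed

text \<open>The column space of \<open>W\<close> is affine and contains the zonotope, hence also its
  affine hull. Preimages of the unit vectors form the columns of \<open>C\<close>.\<close>

lemma zonotope_of_spanning:
  assumes full: "full_dimensional d (zonotope_of d n W)"
  obtains C where "\<And>i k. i < d \<Longrightarrow> k < d \<Longrightarrow> (\<Sum>j<n. W i j * C j k) = (if i = k then 1 else 0)"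
proof -
  \<comment> \<open>Only the first \<open>d\<close> coordinates are constrained, so \<open>S\<close>
    is a cylinder over the column space.\<close>
  define S where "S = {v. \<exists>c. \<forall>i<d. Poly_Mapping.lookup v i = (\<Sum>j<n. W i j * c j)}"
  have "affine S"
    unfolding affine_def
  proof (intro ballI allI impI)
    fix x y and a b :: real assume "x \<in> S" "y \<in> S" "a + b = 1"
    then obtain c c' where c: "\<forall>i<d. Poly_Mapping.lookup x i = (\<Sum>j<n. W i j * c j)"
      "\<forall>i<d. Poly_Mapping.lookup y i = (\<Sum>j<n. W i j * c' j)"
      by (auto simp: S_def)
    show "a *\<^sub>R x + b *\<^sub>R y \<in> S"
      unfolding S_def
      by (rule CollectI, rule exI[of _ "\<lambda>j. a * c j + b * c' j"])
        (auto simp: c lookup_add lookup_scaleR sum_distrib_left sum.distrib algebra_simps)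
  qed
  moreover have "zonotope_of d n W \<subseteq> S"
    by (auto simp: zonotope_of_def S_def)
  ultimately have "affine hull zonotope_of d n W \<subseteq> S"
    by (rule hull_minimal[rotated])
  then have E: "euclidean_space_of_dim d \<subseteq> S"
    using full by (simp add: full_dimensional_def)
  have "\<exists>c. \<forall>i<d. (\<Sum>j<n. W i j * c j) = (if i = k then 1 else 0)" if "k < d" for k
  proof -
    have "Poly_Mapping.single k 1 \<in> S"
      using that E by (auto simp: euclidean_space_of_dim_def)
    then obtain c where "\<forall>i<d. Poly_Mapping.lookup (Poly_Mapping.single k (1 :: real)) i = (\<Sum>j<n. W i j * c j)"
      by (auto simp: S_def)
    then show ?thesis
      by (intro exI[of _ c]) (auto simp: lookup_single when_def)
  qed
  then obtain C where "\<And>k. k < d \<Longrightarrow> \<forall>i<d. (\<Sum>j<n. W i j * C k j) = (if i = k then 1 else 0)"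
    by metis
  then show ?thesis
    by (intro that[of "\<lambda>j k. C k j"]) auto
qed

text \<open>The sublevel set of \<open>f\<close> at its maximum over \<open>A\<close> is convex and
  contains \<open>A\<close>.\<close>

lemma convex_hull_le_vertex:
  fixes f :: "'a :: real_vector \<Rightarrow> real"
  assumes f: "\<And>x y. f (x + y) = f x + f y" "\<And>c x. f (c *\<^sub>R x) = c * f x"
    and p: "p \<in> convex hull A" and A: "finite A"
  shows "\<exists>x\<in>A. f p \<le> f x"
proof -
  have ne: "A \<noteq> {}"
    using p by auto
  have "convex {x. f x \<le> Max (f ` A)}"
    unfolding convex_def by (auto simp: f intro: convex_bound_le)
  then have "convex hull A \<subseteq> {x. f x \<le> Max (f ` A)}"
    using A by (intro hull_minimal) auto
  then have "f p \<le> Max (f ` A)"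
    using p by blast
  moreover have "Max (f ` A) \<in> f ` A"
    using A ne by simp
  ultimately show ?thesis
    by auto
qed

lemma support_function_zonotope_of_le:
  fixes x :: "nat \<Rightarrow> nat \<Rightarrow>\<^sub>0 real"
  assumes P: "P = convex hull (x ` {1..N})" and Z: "zonotope_of d n W \<subseteq> (*\<^sub>R) s ` P" and s: "s > 0"
  shows "\<exists>k\<in>{1..N}. (\<Sum>j<n. \<bar>\<Sum>i<d. a i * W i j\<bar>) \<le> s * (\<Sum>i<d. a i * Poly_Mapping.lookup (x k) i)"
proof -
  define f where "f v = (\<Sum>i<d. a i * Poly_Mapping.lookup v i)" for v :: "nat \<Rightarrow>\<^sub>0 real"
  \<comment> \<open>These signs make \<open>W t\<close> maximise the functional \<open>a\<close>
    over the zonotope; where \<open>sgn\<close> is 0, the summand is 0 too.\<close>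
  define t where "t j = sgn (\<Sum>i<d. a i * W i j)" for j
  define z where "z = Poly_Mapping.Abs_poly_mapping (\<lambda>i. if i < d then \<Sum>j<n. W i j * t j else 0)"
  have z: "Poly_Mapping.lookup z = (\<lambda>i. if i < d then \<Sum>j<n. W i j * t j else 0)"
    unfolding z_def by (rule lookup_Abs_poly_mapping) (auto intro: finite_subset[of _ "{..<d}"])
  have "z \<in> zonotope_of d n W"
    unfolding zonotope_of_def euclidean_space_of_dim_def
    by (auto simp: z in_keys_iff t_def abs_sgn_eq intro!: exI[of _ t] split: if_splits)
  then obtain p where p: "p \<in> P" "z = s *\<^sub>R p"
    using Z by blast
  have "\<exists>y\<in>x ` {1..N}. f p \<le> f y"
    using p P by (intro convex_hull_le_vertex)
      (auto simp: f_def lookup_add lookup_scaleR algebra_simps sum.distrib sum_distrib_left)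
  then obtain k where k: "k \<in> {1..N}" "f p \<le> f (x k)"
    by auto
  have "(\<Sum>j<n. \<bar>\<Sum>i<d. a i * W i j\<bar>) = (\<Sum>j<n. (\<Sum>i<d. a i * W i j) * t j)"
    by (simp add: t_def abs_sgn)
  also have "\<dots> = (\<Sum>i<d. a i * (\<Sum>j<n. W i j * t j))"
    unfolding sum_distrib_left sum_distrib_right by (subst sum.swap) (simp add: mult.assoc)
  also have "\<dots> = f z"
    by (simp add: f_def z)
  also have "\<dots> = s * f p"
    by (simp add: p f_def lookup_scaleR sum_distrib_left mult_ac)
  also have "\<dots> \<le> s * f (x k)"
    using k s by simp
  finally show ?thesis
    using k by (auto simp: f_def)
qed

text \<open>The one extra power of \<open>d\<close> absorbs the sum \<open>M\<close> of the absolute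
  coefficients.\<close>

lemma eventually_poly_le_power:
  fixes p :: "real poly"
  shows "\<forall>\<^sub>F d in sequentially. poly p (real d) \<le> real d ^ Suc (degree p)"
proof -
  define M where "M = (\<Sum>i\<le>degree p. \<bar>coeff p i\<bar>)"
  show ?thesis
    using eventually_ge_at_top[of "max 1 (nat \<lceil>M\<rceil>)"]
  proof eventually_elim
    case (elim d)
    then have d: "1 \<le> real d" "M \<le> real d"
      by linarith+
    have "poly p (real d) = (\<Sum>i\<le>degree p. coeff p i * real d ^ i)"
      by (rule poly_altdef)
    also have "\<dots> \<le> (\<Sum>i\<le>degree p. \<bar>coeff p i\<bar> * real d ^ degree p)"
      using d by (intro sum_mono mult_mono power_increasing) auto
    also have "\<dots> = M * real d ^ degree p"
      by (simp add: M_def sum_distrib_right)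
    also have "\<dots> \<le> real d * real d ^ degree p"
      using d by (intro mult_right_mono) auto
    finally show ?case
      by simp
  qed
qed

theorem theorem4p4:
  fixes p :: "real poly"
  shows "\<exists>c>0. \<forall>\<^sub>F d in sequentially.
    \<forall>(Z :: (nat \<Rightarrow>\<^sub>0 real) set) (P :: (nat \<Rightarrow>\<^sub>0 real) set) (N :: nat) (x :: nat \<Rightarrow> nat \<Rightarrow>\<^sub>0 real) (s :: real).
      zonotope d Z \<and> full_dimensional d Z \<and>
      (\<forall>k\<in>{1..N}. x k \<in> euclidean_space_of_dim d) \<and> P = convex hull (x ` {1..N}) \<and>
      real N \<le> poly p (real d) \<and>
      0 < s \<and> P \<subseteq> Z \<and> Z \<subseteq> (*\<^sub>R) s ` P
      \<longrightarrow> s \<ge> c * sqrt (real d / ln (real d))"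
proof -
  define m where "m = real (Suc (degree p))"
  have m: "m > 0"
    by (simp add: m_def)
  show ?thesis
  \<comment> \<open>The vertex count is at most \<open>d ^ Suc (degree p) = exp (m * ln d)\<close>,
    so the bound is used with \<open>L = m * ln d\<close>, and \<open>sqrt m\<close> moves into the
    constant.\<close>
  proof (rule exI[of _ "9 / 64 / sqrt m"], intro conjI)
    show "9 / 64 / sqrt m > 0"
      using m by simp
    show "\<forall>\<^sub>F d in sequentially.
    \<forall>(Z :: (nat \<Rightarrow>\<^sub>0 real) set) (P :: (nat \<Rightarrow>\<^sub>0 real) set) (N :: nat) (x :: nat \<Rightarrow> nat \<Rightarrow>\<^sub>0 real) (s :: real).
      zonotope d Z \<and> full_dimensional d Z \<and>
      (\<forall>k\<in>{1..N}. x k \<in> euclidean_space_of_dim d) \<and> P = convex hull (x ` {1..N}) \<and>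
      real N \<le> poly p (real d) \<and>
      0 < s \<and> P \<subseteq> Z \<and> Z \<subseteq> (*\<^sub>R) s ` P
      \<longrightarrow> s \<ge> 9 / 64 / sqrt m * sqrt (real d / ln (real d))"
      using eventually_poly_le_power[of p] eventually_ge_at_top[of 2]
    proof (eventually_elim, intro allI impI, elim conjE)
      fix d N and Z P :: "(nat \<Rightarrow>\<^sub>0 real) set" and x :: "nat \<Rightarrow> nat \<Rightarrow>\<^sub>0 real" and s :: real
      assume d: "2 \<le> d" and pd: "poly p (real d) \<le> real d ^ Suc (degree p)"
        and Z: "zonotope d Z" "full_dimensional d Z" and P: "P = convex hull (x ` {1..N})"
        and N: "real N \<le> poly p (real d)" and s: "0 < s" and PZ: "P \<subseteq> Z" and ZP: "Z \<subseteq> (*\<^sub>R) s ` P"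
      obtain n W where W: "Z = zonotope_of d n W"
        using Z by (auto simp: zonotope_def)
      obtain C where C: "\<And>i k. i < d \<Longrightarrow> k < d \<Longrightarrow> (\<Sum>j<n. W i j * C j k) = (if i = k then 1 else 0)"
        using zonotope_of_spanning Z unfolding W by blast
      have lnd: "ln (real d) > 0"
        using d by simp
      have "real d ^ Suc (degree p) = exp (m * ln (real d))"
        using d unfolding m_def by (subst exp_of_nat_mult) simp
      then have card: "real (card {1..N}) \<le> exp (m * ln (real d))"
        using N pd by simp
      have "9 / 64 * sqrt (real d / (m * ln (real d))) \<le> s"
      \<comment> \<open>The generators are the columns of \<open>W\<close>, hence the swapped
        indices.\<close>
      proof (rule zonotope_approximation_bound[where w = "\<lambda>j i. W i j" and K = "{1..N}" and
          z = "\<lambda>k. Poly_Mapping.lookup (x k)", OF _ C _ card _ s])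
        show "\<exists>t. (\<forall>j<n. \<bar>t j\<bar> \<le> 1) \<and> (\<forall>i<d. Poly_Mapping.lookup (x k) i = (\<Sum>j<n. W i j * t j))"
          if k: "k \<in> {1..N}" for k
        proof -
          have "x k \<in> Z"
            using k PZ unfolding P by (meson hull_inc image_eqI subsetD)
          then show ?thesis
            by (auto simp: W zonotope_of_def)
        qed
        show "\<exists>k\<in>{1..N}. (\<Sum>j<n. \<bar>\<Sum>i<d. a i * W i j\<bar>) \<le> s * (\<Sum>i<d. a i * Poly_Mapping.lookup (x k) i)" for a
          using support_function_zonotope_of_le[OF P _ s] ZP unfolding W by blast
      qed (use d m lnd in auto)
      then show "9 / 64 / sqrt m * sqrt (real d / ln (real d)) \<le> s"
        by (simp add: real_sqrt_divide real_sqrt_mult)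
    qed
  qed
qed

end
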